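(* Let $\rho\in(0,1)$, $\alpha(\rho)=-\log(1-\rho)$, and let $\tilde\eta$ be sampled from $\tilde{\mathbb P}_{\alpha(\rho)}$. Then $[\tilde\eta]\in\mathcal X$ has law $\mathbb P_\rho$. Consequently, for every $u:\mathcal X\to\mathbb R$ integrable under $\mathbb P_\rho$, the function $[u]$ satisfies $$\langle\!\langle[u]\rangle\!\rangle_{\alpha(\rho)}=\langle u\rangle_\rho.$$
   Context: $\mathcal X=\{0,1\}^{\mathbb Z^d}$ and $\mathbb P_\rho$, $\langle\cdot\rangle_\rho$ are the product Bernoulli measure of density $\rho$ on $\mathcal X$ and its expectation. $\tilde{\mathcal X}=\mathbb N^{\mathbb Z^d}$ with $\mathbb N=\{0,1,2,\dots\}$; for $\alpha>0$, $\tilde{\mathbb P}_\alpha=\mathrm{Poi}(\alpha)^{\otimes\mathbb Z^d}$ is the product of Poisson laws of mean $\alpha$, with expectation $\langle\!\langle\cdot\rangle\!\rangle_\alpha$. The projection $[\cdot]:\tilde{\mathcal X}\to\mathcal X$ is $[\tilde\eta]_x=\mathbf 1_{\{\tilde\eta_x\ge1\}}$ for all $x\in\mathbb Z^d$, and for $u:\mathcal X\to\mathbb R$, $[u]:\tilde{\mathcal X}\to\mathbb R$ is $[u](\tilde\eta)=u([\tilde\eta])$. *)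

theory Defs
  imports "HOL-Probability.Probability"
begin

text \<open>
  The lattice \<open>\<int>\<^sup>d\<close> is \<^typ>\<open>int ^ 'd\<close> with \<open>d = CARD('d)\<close>. The two-point set \<open>{0,1}\<close> is \<^typ>\<open>bool\<close>,
  with \<^term>\<open>True\<close> for 1 (occupied) and \<^term>\<open>False\<close> for 0 (empty).
\<close>

type_synonym 'd config = "int ^ 'd \<Rightarrow> bool"

type_synonym 'd nat_config = "int ^ 'd \<Rightarrow> nat"

text \<open>
  Both measures live on the product sigma-algebra generated by the coordinate maps, every
  single-site space being discrete.
\<close>

definition bernoulli_product :: "real \<Rightarrow> ('d::finite) config measure" where
  "bernoulli_product \<rho> = (\<Pi>\<^sub>M x\<in>UNIV. measure_pmf (bernoulli_pmf \<rho>))"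

definition poisson_product :: "real \<Rightarrow> ('d::finite) nat_config measure" where
  "poisson_product \<alpha> = (\<Pi>\<^sub>M x\<in>UNIV. measure_pmf (poisson_pmf \<alpha>))"

definition proj :: "('d::finite) nat_config \<Rightarrow> 'd config" where
  "proj \<eta> = (\<lambda>x. \<eta> x \<ge> 1)"

definition proj_fun :: "(('d::finite) config \<Rightarrow> real) \<Rightarrow> 'd nat_config \<Rightarrow> real" where
  "proj_fun u = (\<lambda>\<eta>. u (proj \<eta>))"

definition poisson_param :: "real \<Rightarrow> real" where
  "poisson_param \<rho> = - ln (1 - \<rho>)"

end

theory Submission
  imports Defs
begin

text \<open>\<open>proj\<close> acts on each site separately, and sites are independent under both
  measures, so the law of the image is the product of the image laws at single sites
  (\<open>distr_PiM_componentwise\<close>). At one site a Poisson variable of mean \<alpha> vanishes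
  with probability exp (- \<alpha>), so its indicator of being positive is Bernoulli of density 1 -
  exp (- \<alpha>) (\<open>map_pmf_poisson_pos\<close>), which is \<rho> for \<alpha> = - ln (1 -
  \<rho>). The identity of expectations is then a change of variables.\<close>

lemma distr_PiM_componentwise:
  assumes M: "\<And>i. i \<in> I \<Longrightarrow> prob_space (M i)"
    and f: "\<And>i. i \<in> I \<Longrightarrow> f i \<in> measurable (M i) (N i)"
  shows "distr (Pi\<^sub>M I M) (Pi\<^sub>M I N) (\<lambda>\<omega>. \<lambda>i\<in>I. f i (\<omega> i)) = (\<Pi>\<^sub>M i\<in>I. distr (M i) (N i) (f i))"
    (is "distr ?M ?N ?t = ?D")
\<comment> \<open>Cylinders over finitely many coordinates form an intersection-stable generator, so
  two finite measures that agree on them coincide.\<close>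
proof (rule measure_eqI_PiM_infinite)
  have t: "?t \<in> measurable ?M ?N"
    using f by (intro measurable_restrict measurable_compose[OF measurable_component_singleton]) auto
  interpret prob_space ?M
    using M by (intro prob_space_PiM)
  show "finite_measure (distr ?M ?N ?t)"
    using prob_space_distr[OF t] by (simp add: prob_space_def)
  show "sets (distr ?M ?N ?t) = sets ?D"
    by (simp cong: sets_PiM_cong)
  fix A J
  assume J: "finite J" "J \<subseteq> I" and "\<And>i. i \<in> J \<Longrightarrow> A i \<in> sets (distr (M i) (N i) (f i))"
  then have A: "A i \<in> sets (N i)" if "i \<in> J" for i
    using that by simp
  have fJ: "f i \<in> measurable (M i) (N i)" if "i \<in> J" for i
    using that J f by auto
  let ?X = "prod_emb I (\<lambda>i. distr (M i) (N i) (f i)) J (Pi\<^sub>E J A)"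
  \<comment> \<open>\<open>prod_emb\<close> sees only the spaces of the factors, and
    \<open>distr (M i) (N i) (f i)\<close> has the space of \<open>N i\<close>.\<close>
  have X: "?X = prod_emb I N J (Pi\<^sub>E J A)"
    by (simp add: prod_emb_def)
  have "emeasure (distr ?M ?N ?t) ?X = emeasure ?M (?t -` prod_emb I N J (Pi\<^sub>E J A) \<inter> space ?M)"
    unfolding X using J A by (intro emeasure_distr t sets_PiM_I) auto
  \<comment> \<open>The preimage is a cylinder over the same \<open>J\<close>: each
    \<open>f i\<close> maps \<open>space (M i)\<close> into \<open>space (N i)\<close>, so
    coordinates outside \<open>J\<close> stay unconstrained.\<close>
  also have "?t -` prod_emb I N J (Pi\<^sub>E J A) \<inter> space ?M
      = prod_emb I M J (\<Pi>\<^sub>E i\<in>J. f i -` A i \<inter> space (M i))"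
    using J measurable_space[OF f] by (auto simp: prod_emb_def space_PiM PiE_iff subset_eq)
  also have "emeasure ?M \<dots> = (\<Prod>i\<in>J. emeasure (M i) (f i -` A i \<inter> space (M i)))"
    using J M fJ A by (intro emeasure_PiM_emb measurable_sets) auto
  also have "\<dots> = (\<Prod>i\<in>J. emeasure (distr (M i) (N i) (f i)) (A i))"
    using fJ A by (intro prod.cong refl emeasure_distr[symmetric])
  also have "\<dots> = emeasure ?D ?X"
    using J A M f by (intro emeasure_PiM_emb[symmetric] prob_space.prob_space_distr) auto
  finally show "emeasure (distr ?M ?N ?t) ?X = emeasure ?D ?X" .
qed simp

lemma map_pmf_poisson_pos:
  assumes "0 < \<alpha>"
  shows "map_pmf (\<lambda>n. 1 \<le> n) (poisson_pmf \<alpha>) = bernoulli_pmf (1 - exp (- \<alpha>))"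
proof (rule pmf_eqI)
  have zero: "measure (poisson_pmf \<alpha>) {0} = exp (- \<alpha>)"
    using assms by (subst measure_pmf_single) simp
  have pos: "measure (poisson_pmf \<alpha>) (UNIV - {0}) = 1 - exp (- \<alpha>)"
    using measure_pmf.prob_compl[of "{0}" "poisson_pmf \<alpha>"] zero by simp
  fix b
  have "(\<lambda>n::nat. 1 \<le> n) -` {b} = (if b then UNIV - {0} else {0})"
    by (cases b) (simp_all add: set_eq_iff Suc_le_eq)
  then have "pmf (map_pmf (\<lambda>n. 1 \<le> n) (poisson_pmf \<alpha>)) b = (if b then 1 - exp (- \<alpha>) else exp (- \<alpha>))"
    unfolding pmf_map using zero pos by (cases b) (simp_all only: if_True if_False)
  also have "\<dots> = pmf (bernoulli_pmf (1 - exp (- \<alpha>))) b"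
    using assms by (cases b) simp_all
  finally show "pmf (map_pmf (\<lambda>n. 1 \<le> n) (poisson_pmf \<alpha>)) b = pmf (bernoulli_pmf (1 - exp (- \<alpha>))) b" .
qed

theorem proposition3p1:
  fixes \<rho> :: real
  assumes "0 < \<rho>" and "\<rho> < 1"
  shows "proj \<in> measurable (poisson_product (poisson_param \<rho>))
                  (bernoulli_product \<rho> :: ('d::finite) config measure)
       \<and> distr (poisson_product (poisson_param \<rho>)) (bernoulli_product \<rho>) proj
           = (bernoulli_product \<rho> :: 'd config measure)
       \<and> (\<forall>u :: 'd config \<Rightarrow> real. integrable (bernoulli_product \<rho>) u \<longrightarrow>
            integrable (poisson_product (poisson_param \<rho>)) (proj_fun u) \<and>
            (\<integral>\<eta>. proj_fun u \<eta> \<partial>poisson_product (poisson_param \<rho>))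
              = (\<integral>\<eta>. u \<eta> \<partial>bernoulli_product \<rho>))"
proof -
  let ?P = "poisson_product (poisson_param \<rho>) :: 'd nat_config measure"
  let ?B = "bernoulli_product \<rho> :: 'd config measure"
  \<comment> \<open>\<open>map_pmf\<close> pushes forward to \<open>count_space UNIV\<close>; only
    the sets of the target matter, and those of \<open>bernoulli_pmf \<rho>\<close> are the
    same.\<close>
  have "distr (poisson_pmf (poisson_param \<rho>)) (bernoulli_pmf \<rho>) (\<lambda>n. 1 \<le> n)
      = measure_pmf (map_pmf (\<lambda>n. 1 \<le> n) (poisson_pmf (poisson_param \<rho>)))"
    unfolding map_pmf_rep_eq by (intro distr_cong) simp_all
  also have "map_pmf (\<lambda>n. 1 \<le> n) (poisson_pmf (poisson_param \<rho>)) = bernoulli_pmf \<rho>"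
    using map_pmf_poisson_pos[of "poisson_param \<rho>"] assms by (simp add: poisson_param_def)
  finally have site: "distr (poisson_pmf (poisson_param \<rho>)) (bernoulli_pmf \<rho>) (\<lambda>n. 1 \<le> n)
      = measure_pmf (bernoulli_pmf \<rho>)" .
  \<comment> \<open>Restriction to \<open>UNIV\<close> changes nothing, but gives
    \<open>proj\<close> the shape of the componentwise map.\<close>
  have proj_restrict: "proj = (\<lambda>\<eta>. \<lambda>x\<in>UNIV. 1 \<le> \<eta> x)"
    by (simp add: proj_def fun_eq_iff)
  have meas: "proj \<in> measurable ?P ?B"
    unfolding proj_restrict poisson_product_def bernoulli_product_def
    by (intro measurable_restrict measurable_compose[OF measurable_component_singleton]) auto
  have law: "distr ?P ?B proj = ?B"
    unfolding proj_restrict poisson_product_def bernoulli_product_def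
    by (subst distr_PiM_componentwise[where f = "\<lambda>_ n. 1 \<le> n"])
      (simp_all add: site measure_pmf.prob_space_axioms del: One_nat_def)
  have "integrable ?P (proj_fun u) \<and> (\<integral>\<eta>. proj_fun u \<eta> \<partial>?P) = (\<integral>\<eta>. u \<eta> \<partial>?B)"
    if u: "integrable ?B u" for u
    \<comment> \<open>Both transfer rules speak of \<open>distr ?P ?B proj\<close>, which
      \<open>law\<close> rewrites to \<open>?B\<close>.\<close>
    using integrable_distr_eq[OF meas, of u] integral_distr[OF meas, of u] u
      borel_measurable_integrable[OF u]
    unfolding law proj_fun_def by simp
  with meas law show ?thesis
    by blast
qed

end
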